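(* Consider the one-dimensional shallow water equations on $\Omega=(x_L,x_R)$ with the finite element setting and notation given in the context. Suppose the numerical solution $\boldsymbol{u}_h=(H_h,q_h)^T$ is a lake at rest steady state, i.e. $\eta_h:=H_h+B_h\equiv\overline\eta$ for a constant $\overline\eta$ and the velocity is identically zero, $q_h\equiv0$. Then, for every $i=1,\dots,I$, each of the following four stabilization terms is exactly zero: (jt) $\displaystyle\boldsymbol{ST}_i(\boldsymbol{u}_h):=\sum_{f\in\mathcal{F}_h}\sum_{r=1}^R\alpha_{f,r}\Big\llbracket\frac{\partial^r}{\partial x^r}\varphi_i\Big\rrbracket\Big\llbracket\frac{\partial^r}{\partial x^r}\begin{pmatrix}\eta_h\\ q_h\end{pmatrix}\Big\rrbracket$; (je) $\displaystyle\boldsymbol{ST}_i(\boldsymbol{u}_h):=\sum_{f\in\mathcal{F}_h}\alpha_f\Big\llbracket\frac{\partial}{\partial x}\varphi_i\Big\rrbracket\mathcal{A}_f\Big\llbracket\frac{\partial}{\partial x}\boldsymbol{w}_h\Big\rrbracket$, where $\boldsymbol{w}_h$ is the interpolant of $\boldsymbol{w}:=\left(g\eta-\frac{v^2}{2},\,v\right)^T$; (jr) $\displaystyle\boldsymbol{ST}_i(\boldsymbol{u}_h):=\sum_{f\in\mathcal{F}_h}\alpha_f\Big\llbracket\boldsymbol{J}\frac{\partial}{\partial x}\varphi_i\Big\rrbracket\mathcal{B}_f\Big\llbracket\boldsymbol{J}\frac{\partial}{\partial x}\boldsymbol{u}_h-\boldsymbol{S}^*\Big\rrbracket$, where $\boldsymbol{S}^*:=-\begin{pmatrix}0\\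 gH_h\frac{\partial}{\partial x}B_h\end{pmatrix}$; (jg) $\displaystyle\boldsymbol{ST}_i(\boldsymbol{u}_h):=\sum_{f\in\mathcal{F}_h}\alpha_f\Big\llbracket\boldsymbol{J}\frac{\partial}{\partial x}\varphi_i\Big\rrbracket\mathcal{B}_f\Big\llbracket\frac{\partial}{\partial x}\boldsymbol{G}_h\Big\rrbracket$, where $\boldsymbol{G}_h$ is the discrete global flux defined in the context.
   Context: Shallow water equations: $\partial_t\boldsymbol{u}+\partial_x\boldsymbol{F}(\boldsymbol{u})=\boldsymbol{S}(x,\boldsymbol{u})$ with $\boldsymbol{u}=(H,q)^T$, $H>0$ the water height, $q=Hv$ the momentum, $v$ the velocity, $g>0$ the gravitational constant, $B=B(x)$ a given bathymetry, $\eta=H+B$ the total height, $c=\sqrt{gH}$, $n_M\ge0$ the Manning friction coefficient, $$\boldsymbol{F}(\boldsymbol{u})=\begin{pmatrix}q\\ \frac{q^2}{H}+g\frac{H^2}{2}\end{pmatrix},\qquad \boldsymbol{S}=\boldsymbol{S}^V+\boldsymbol{S}^{HS},\quad \boldsymbol{S}^V=-\begin{pmatrix}0\\ g\frac{n_M^2|q|}{H^{7/3}}q\end{pmatrix},\quad \boldsymbol{S}^{HS}=-\begin{pmatrix}0\\ gH\frac{\partial}{\partial x}B\end{pmatrix}.$$ Finite element setting: $\mathcal{T}_h$ is a finite subdivision of $[x_L,x_R]$ into non-overlapping closed segments $K$; $\mathcal{F}_h$ is the set of interfaces (points) shared by two elements; $W_M:=\{\varphi\in C^0([x_L,x_R]):\varphi|_K\in\mathbb{P}_M(K)\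 \forall K\in\mathcal{T}_h\}$ (polynomials of degree at most $M$, $M\ge1$, on each element). $\{\varphi_i\}_{i=1}^I$ is a basis of $W_M$ with $\sum_i\varphi_i\equiv1$, each $\varphi_i$ associated with a node $x_i$ and vanishing outside the union of the elements containing $x_i$ (e.g. Bernstein polynomials, or Lagrange polynomials at equispaced or Gauss–Lobatto nodes). Each element contains $M+1$ distinct nodes, including its two endpoints. Interpolation: for a function $z$, its interpolant $z_h=[z]_h=\sum_i z_i\varphi_i\in W_M$ is the unique element of $W_M$ with $z_h(x_i)=z(x_i)$ at all nodes; $z_i$ are its coefficients. For quantities possibly discontinuous across elements the interpolation is performed separately in each element, using the nodes of that element and the restriction to it. The numerical solution is $\boldsymbol{u}_h=(H_h,q_h)^T\in W_M^2$, $B_h$ is the interpolant of $B$; nodal values of nonlinear quantities are computed from $\boldsymbol{u}_h(x_i)$ and $B(x_i)$. Time is frozen. Jumps and coefficients: $\llbracket z\rrbracket$ is the difference of the two one-sided limits of $z$ at $f$ (direction arbitrary, the same for both jumps in each product). $R\ge1$ is an integer; $\alpha_{f,r},\alpha_f\in\mathbb{R}$ are given scalar coefficients ($\alpha_{f,r}=\delta_r\bar\rho_fh_f^{2r}$, $\alpha_f=\delta\bar\rho_fh_f^2$, with $\delta_r,\delta$ constants, $\bar\rho_f$ a local spectral radius, $h_f$ a local mesh size). Matrices, all evaluated at the interface $f$ from the (continuous) values of $\boldsymbol{u}_h$: $$\boldsymbol{J}=\frac{\partial\boldsymbol{F}}{\partial\boldsymbol{u}}=\begin{pmatrix}0&1\\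 -\frac{q^2}{H^2}+gH&2\frac{q}{H}\end{pmatrix},\qquad \mathcal{A}_f=\begin{pmatrix}\frac1g&\frac vg\\ \frac vg&H+\frac{v^2}{g}\end{pmatrix},\qquad \mathcal{B}_f=|\boldsymbol{J}|^{-1},$$ where $|\boldsymbol{J}|=P|\Lambda|P^{-1}$ with $P=\begin{pmatrix}1&1\\ v-c&v+c\end{pmatrix}$ and $|\Lambda|=\mathrm{diag}(|v-c|,|v+c|)$. Discrete global flux: $\boldsymbol{G}_h\in W_M^2$ is the interpolant of the nodal values $\boldsymbol{G}_h(x_i)=\boldsymbol{F}(\boldsymbol{u}_h(x_i))+\boldsymbol{R}_h(x_i)$ with $$\boldsymbol{R}_h(x_i)=-\int_{x_L}^{x_i}\left[-\begin{pmatrix}0\\ \left[gH\frac{\partial}{\partial x}B\right]_h(s)\end{pmatrix}+\sum_{j=1}^I\boldsymbol{S}^V_j\varphi_j(s)\right]ds,$$ where $\boldsymbol{S}^V_j$ are the interpolation coefficients of $\boldsymbol{S}^V(\boldsymbol{u}_h)$ and, in each element $K$, $\left[gH\frac{\partial}{\partial x}B\right]_h:=\left[g(H_h+B_h)\frac{\partial}{\partial x}B_h\right]_h-\frac{\partial}{\partial x}\left[\frac{gB^2}{2}\right]_h$, the brackets on the right-hand side denoting interpolation (element by element for the first). *)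

theory Defs
  imports "HOL-Analysis.Analysis" "HOL-Computational_Algebra.Polynomial"
begin

section \<open>Finite element space\<close>

text \<open>Functions on the interval are total functions on \<^typ>\<open>real\<close> of which only the values on
  \<open>{xL..xR}\<close> matter. Nodes and basis functions are indexed by \<open>1, \<dots>, num\<close>.\<close>

record fe_space =
  xL :: real
  xR :: real
  mesh :: "real set set"
  deg :: nat
  num :: nat
  node :: "nat \<Rightarrow> real"
  shape :: "nat \<Rightarrow> real \<Rightarrow> real"

definition interfaces :: "fe_space \<Rightarrow> real set" where
  "interfaces V = {f. \<exists>K\<in>mesh V. \<exists>L\<in>mesh V. K \<noteq> L \<and> f \<in> K \<inter> L}"

definition W :: "fe_space \<Rightarrow> (real \<Rightarrow> real) set" where
  "W V = {w. continuous_on {xL V..xR V} w \<and>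
     (\<forall>K\<in>mesh V. \<exists>p::real poly. degree p \<le> deg V \<and> (\<forall>s\<in>K. w s = poly p s))}"

definition basis_of_W :: "fe_space \<Rightarrow> bool" where
  "basis_of_W V \<longleftrightarrow>
     (\<forall>i\<in>{1..num V}. shape V i \<in> W V) \<and>
     (\<forall>c. (\<forall>s\<in>{xL V..xR V}. (\<Sum>i=1..num V. c i * shape V i s) = 0) \<longrightarrow>
        (\<forall>i\<in>{1..num V}. c i = 0)) \<and>
     (\<forall>w\<in>W V. \<exists>c. \<forall>s\<in>{xL V..xR V}. w s = (\<Sum>i=1..num V. c i * shape V i s))"

text \<open>\<open>division_of\<close> allows degenerate intervals; these are excluded separately.\<close>

definition valid_fe_space :: "fe_space \<Rightarrow> bool" where
  "valid_fe_space V \<longleftrightarrow>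
     xL V < xR V \<and> deg V \<ge> 1 \<and>
     mesh V division_of {xL V..xR V} \<and> (\<forall>K\<in>mesh V. interior K \<noteq> {}) \<and>
     inj_on (node V) {1..num V} \<and> node V ` {1..num V} \<subseteq> {xL V..xR V} \<and>
     (\<forall>K\<in>mesh V. card (node V ` {1..num V} \<inter> K) = deg V + 1) \<and>
     (\<forall>a b. a < b \<longrightarrow> {a..b} \<in> mesh V \<longrightarrow> {a, b} \<subseteq> node V ` {1..num V}) \<and>
     basis_of_W V \<and>
     (\<forall>s\<in>{xL V..xR V}. (\<Sum>i=1..num V. shape V i s) = 1) \<and>
     (\<forall>i\<in>{1..num V}. \<forall>s\<in>{xL V..xR V} - \<Union>{K\<in>mesh V. node V i \<in> K}. shape V i s = 0)"

section \<open>Interpolation, derivatives and jumps\<close>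

definition interp_coeffs :: "fe_space \<Rightarrow> (real \<Rightarrow> 'a::real_vector) \<Rightarrow> nat \<Rightarrow> 'a" where
  "interp_coeffs V z = (SOME c. \<forall>k\<in>{1..num V}.
     (\<Sum>j=1..num V. shape V j (node V k) *\<^sub>R c j) = z (node V k))"

definition interp :: "fe_space \<Rightarrow> (real \<Rightarrow> 'a::real_vector) \<Rightarrow> real \<Rightarrow> 'a" where
  "interp V z s = (\<Sum>i=1..num V. shape V i s *\<^sub>R interp_coeffs V z i)"

definition elem_interp :: "fe_space \<Rightarrow> real set \<Rightarrow> (real \<Rightarrow> real) \<Rightarrow> real \<Rightarrow> real" where
  "elem_interp V K z = poly (THE p. degree p \<le> deg V \<and>
     (\<forall>i\<in>{1..num V}. node V i \<in> K \<longrightarrow> poly p (node V i) = z (node V i)))"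

definition ddx :: "(real \<Rightarrow> 'a::real_normed_vector) \<Rightarrow> real \<Rightarrow> 'a" where
  "ddx z = (\<lambda>s. vector_derivative z (at s))"

definition jump :: "(real \<Rightarrow> 'a::real_normed_vector) \<Rightarrow> real \<Rightarrow> 'a" where
  "jump z f = Lim (at_right f) z - Lim (at_left f) z"

section \<open>Shallow water quantities\<close>

text \<open>A state \<open>u :: real^2\<close> has components \<open>u $ 1 = H\<close> and \<open>u $ 2 = q\<close>.\<close>

definition velocity :: "real^2 \<Rightarrow> real" where
  "velocity u = u $ 2 / u $ 1"

definition celerity :: "real \<Rightarrow> real^2 \<Rightarrow> real" where
  "celerity g u = sqrt (g * u $ 1)"

definition flux :: "real \<Rightarrow> real^2 \<Rightarrow> real^2" where
  "flux g u = vector [u $ 2, (u $ 2)\<^sup>2 / u $ 1 + g * (u $ 1)\<^sup>2 / 2]"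

definition friction :: "real \<Rightarrow> real \<Rightarrow> real^2 \<Rightarrow> real^2" where
  "friction g nM u = - vector [0, g * nM\<^sup>2 * \<bar>u $ 2\<bar> / (u $ 1) powr (7/3) * u $ 2]"

definition jac :: "real \<Rightarrow> real^2 \<Rightarrow> real^2^2" where
  "jac g u = vector [vector [0, 1],
     vector [- (u $ 2)\<^sup>2 / (u $ 1)\<^sup>2 + g * u $ 1, 2 * (u $ 2 / u $ 1)]]"

definition abs_jac :: "real \<Rightarrow> real^2 \<Rightarrow> real^2^2" where
  "abs_jac g u =
     (let v = velocity u; c = celerity g u;
          P = vector [vector [1, 1], vector [v - c, v + c]] :: real^2^2;
          L = vector [vector [\<bar>v - c\<bar>, 0], vector [0, \<bar>v + c\<bar>]] :: real^2^2
      in P ** L ** matrix_inv P)"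

definition matA :: "real \<Rightarrow> real^2 \<Rightarrow> real^2^2" where
  "matA g u = (let v = velocity u in
     vector [vector [1 / g, v / g], vector [v / g, u $ 1 + v\<^sup>2 / g]])"

definition matB :: "real \<Rightarrow> real^2 \<Rightarrow> real^2^2" where
  "matB g u = matrix_inv (abs_jac g u)"

definition total_height :: "fe_space \<Rightarrow> (real \<Rightarrow> real) \<Rightarrow> (real \<Rightarrow> real^2) \<Rightarrow> real \<Rightarrow> real" where
  "total_height V B u s = u s $ 1 + interp V B s"

definition numerical_solution :: "fe_space \<Rightarrow> (real \<Rightarrow> real^2) \<Rightarrow> bool" where
  "numerical_solution V u \<longleftrightarrow>
     (\<lambda>s. u s $ 1) \<in> W V \<and> (\<lambda>s. u s $ 2) \<in> W V \<and> (\<forall>s\<in>{xL V..xR V}. u s $ 1 > 0)"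

definition lake_at_rest :: "fe_space \<Rightarrow> (real \<Rightarrow> real) \<Rightarrow> (real \<Rightarrow> real^2) \<Rightarrow> real \<Rightarrow> bool" where
  "lake_at_rest V B u etabar \<longleftrightarrow>
     (\<forall>s\<in>{xL V..xR V}. total_height V B u s = etabar \<and> u s $ 2 = 0)"

section \<open>Discrete global flux\<close>

text \<open>The derivatives are taken within the closed element \<open>K\<close>, hence one-sided at its end points:
  each quantity is first restricted to \<open>K\<close>.\<close>

definition gHBx_elem ::
  "fe_space \<Rightarrow> real \<Rightarrow> (real \<Rightarrow> real) \<Rightarrow> (real \<Rightarrow> real^2) \<Rightarrow> real set \<Rightarrow> real \<Rightarrow> real" where
  "gHBx_elem V g B u K s =
     elem_interp V K
       (\<lambda>y. g * (u y $ 1 + interp V B y) * vector_derivative (interp V B) (at y within K)) s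
     - vector_derivative (interp V (\<lambda>y. g * (B y)\<^sup>2 / 2)) (at s within K)"

text \<open>At an interface either adjacent element may be chosen; this does not affect integrals.\<close>

definition gHBx ::
  "fe_space \<Rightarrow> real \<Rightarrow> (real \<Rightarrow> real) \<Rightarrow> (real \<Rightarrow> real^2) \<Rightarrow> real \<Rightarrow> real" where
  "gHBx V g B u s = gHBx_elem V g B u (SOME K. K \<in> mesh V \<and> s \<in> K) s"

definition R_h ::
  "fe_space \<Rightarrow> real \<Rightarrow> real \<Rightarrow> (real \<Rightarrow> real) \<Rightarrow> (real \<Rightarrow> real^2) \<Rightarrow> real \<Rightarrow> real^2" where
  "R_h V g nM B u y = - integral {xL V..y} (\<lambda>s.
     - vector [0, gHBx V g B u s]
     + (\<Sum>j=1..num V. shape V j s *\<^sub>R interp_coeffs V (\<lambda>t. friction g nM (u t)) j))"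

definition global_flux ::
  "fe_space \<Rightarrow> real \<Rightarrow> real \<Rightarrow> (real \<Rightarrow> real) \<Rightarrow> (real \<Rightarrow> real^2) \<Rightarrow> real \<Rightarrow> real^2" where
  "global_flux V g nM B u = interp V (\<lambda>y. flux g (u y) + R_h V g nM B u y)"

section \<open>Stabilization terms\<close>

definition ST_jt ::
  "fe_space \<Rightarrow> (real \<Rightarrow> nat \<Rightarrow> real) \<Rightarrow> nat \<Rightarrow> (real \<Rightarrow> real) \<Rightarrow> (real \<Rightarrow> real^2) \<Rightarrow> nat \<Rightarrow> real^2" where
  "ST_jt V \<alpha> R B u i = (\<Sum>f\<in>interfaces V. \<Sum>r=1..R.
     (\<alpha> f r * jump ((ddx ^^ r) (shape V i)) f) *\<^sub>R
       jump ((ddx ^^ r) (\<lambda>s. vector [total_height V B u s, u s $ 2] :: real^2)) f)"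

text \<open>The entropy variables \<open>w\<close>, to be evaluated at the nodes.\<close>

definition entropy_var ::
  "real \<Rightarrow> (real \<Rightarrow> real) \<Rightarrow> (real \<Rightarrow> real^2) \<Rightarrow> real \<Rightarrow> real^2" where
  "entropy_var g B u y =
     vector [g * (u y $ 1 + B y) - (velocity (u y))\<^sup>2 / 2, velocity (u y)]"

definition ST_je ::
  "fe_space \<Rightarrow> (real \<Rightarrow> real) \<Rightarrow> real \<Rightarrow> (real \<Rightarrow> real) \<Rightarrow> (real \<Rightarrow> real^2) \<Rightarrow> nat \<Rightarrow> real^2" where
  "ST_je V \<alpha> g B u i = (\<Sum>f\<in>interfaces V.
     (\<alpha> f * jump (ddx (shape V i)) f) *\<^sub>R
       (matA g (u f) *v jump (ddx (interp V (entropy_var g B u))) f))"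

definition S_star ::
  "fe_space \<Rightarrow> real \<Rightarrow> (real \<Rightarrow> real) \<Rightarrow> (real \<Rightarrow> real^2) \<Rightarrow> real \<Rightarrow> real^2" where
  "S_star V g B u s = - vector [0, g * u s $ 1 * ddx (interp V B) s]"

text \<open>In the next two terms the Jacobian is frozen at its value at the interface, where \<open>u\<close> is
  continuous.\<close>

definition ST_jr ::
  "fe_space \<Rightarrow> (real \<Rightarrow> real) \<Rightarrow> real \<Rightarrow> (real \<Rightarrow> real) \<Rightarrow> (real \<Rightarrow> real^2) \<Rightarrow> nat \<Rightarrow> real^2" where
  "ST_jr V \<alpha> g B u i = (\<Sum>f\<in>interfaces V. \<alpha> f *\<^sub>R
     (jump (\<lambda>s. ddx (shape V i) s *\<^sub>R jac g (u f)) f *v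
       (matB g (u f) *v jump (\<lambda>s. jac g (u f) *v ddx u s - S_star V g B u s) f)))"

definition ST_jg ::
  "fe_space \<Rightarrow> (real \<Rightarrow> real) \<Rightarrow> real \<Rightarrow> real \<Rightarrow> (real \<Rightarrow> real) \<Rightarrow> (real \<Rightarrow> real^2) \<Rightarrow> nat \<Rightarrow> real^2" where
  "ST_jg V \<alpha> g nM B u i = (\<Sum>f\<in>interfaces V. \<alpha> f *\<^sub>R
     (jump (\<lambda>s. ddx (shape V i) s *\<^sub>R jac g (u f)) f *v
       (matB g (u f) *v jump (ddx (global_flux V g nM B u)) f)))"

end

theory Submission
  imports Defs
begin

text \<open>
  On \<open>[xL, xR]\<close> each stabilization term is a sum of products whose last factor is a jump of a
  quantity that the lake at rest keeps trivial.

  In the first, second and fourth term that quantity is the derivative of a constant. For the jump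
  of derivatives, total height and momentum are constant by assumption. The entropy variables equal
  \<open>(g \<eta>, 0)\<close> at every node, and an interpolant of constant nodal values is constant
  (\<open>interp_const\<close>), because the basis functions sum to one and a function of \<open>W\<close> is determined
  by its nodal values (\<open>W_zero_at_nodes\<close>: on each element it is a polynomial of degree at most
  \<open>M\<close> with \<open>M + 1\<close> prescribed values). For the global flux, \<open>[g (H + B) B']\<close> is
  \<open>g \<eta> B\<^sub>h'\<close> on each element, since \<open>B\<^sub>h'\<close> already has degree below \<open>M\<close> and is
  reproduced by the elementwise interpolation; so the source term is the derivative of
  \<open>g \<eta> B\<^sub>h - [g B\<^sup>2 / 2]\<^sub>h\<close>, which is continuous and may be integrated across interfaces
  (\<open>R_h_at_rest\<close>). At a node this primitive is \<open>g \<eta> B - g B\<^sup>2 / 2\<close>, and adding the pressure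
  \<open>g (\<eta> - B)\<^sup>2 / 2\<close> leaves \<open>g \<eta>\<^sup>2 / 2\<close> up to a constant of integration
  (\<open>global_flux_at_rest\<close>).

  In the third term the residual is not constant, but since \<open>H' = - B\<^sub>h'\<close> inside the elements it
  has the form \<open>g (H(s) - H(f)) B\<^sub>h'(s)\<close> in the second component (\<open>residual_at_rest\<close>).
  Both one-sided limits at \<open>f\<close> are zero: \<open>H\<close> is continuous and \<open>B\<^sub>h'\<close> is bounded near \<open>f\<close>.

  Interpolants attain the prescribed nodal values (\<open>interp_node\<close>) although \<open>basis_of_W\<close> and the
  node counts give only uniqueness directly: nodes and basis functions are equally many, and a square
  system with at most one solution has one.
\<close>

section \<open>Square linear systems\<close>

text \<open>One step of Gaussian elimination removes an equation together with an unknown, so the surplus of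
  unknowns survives until no equation is left.\<close>

lemma homogeneous_system_nontrivial_solution:
  fixes a :: "'k \<Rightarrow> 'j \<Rightarrow> real"
  assumes "finite K" "finite J" "card K < card J"
  shows "\<exists>c. (\<exists>j\<in>J. c j \<noteq> 0) \<and> (\<forall>k\<in>K. (\<Sum>j\<in>J. a k j * c j) = 0)"
  using assms
proof (induction K arbitrary: J a rule: finite_induct)
  case empty
  then have "J \<noteq> {}" by auto
  then show ?case by (intro exI[of _ "\<lambda>_. 1"]) auto
next
  case (insert k K)
  show ?case
  proof (cases "\<forall>j\<in>J. a k j = 0")
    case True
    with insert.IH[of J a] insert.prems insert.hyps show ?thesis by auto
  next
    case False
    then obtain l where l: "l \<in> J" "a k l \<noteq> 0" by auto
    define J' where "J' = J - {l}"
    have J: "J = insert l J'" "l \<notin> J'" "finite J'"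
      using l insert.prems by (auto simp: J'_def)
    have "card K < card J'" using insert.prems insert.hyps J by simp
    from insert.IH[OF J(3) this, of "\<lambda>m j. a m j - a m l * a k j / a k l"]
    obtain c where c: "\<exists>j\<in>J'. c j \<noteq> 0"
      "\<forall>m\<in>K. (\<Sum>j\<in>J'. (a m j - a m l * a k j / a k l) * c j) = 0" by auto
    define d where "d = c(l := - (\<Sum>j\<in>J'. a k j * c j) / a k l)"
    have d: "(\<Sum>j\<in>J. a m j * d j) =
        (\<Sum>j\<in>J'. a m j * c j) - a m l * (\<Sum>j\<in>J'. a k j * c j) / a k l" for m
    proof -
      have "(\<Sum>j\<in>J'. a m j * d j) = (\<Sum>j\<in>J'. a m j * c j)"
        using J(2) by (intro sum.cong) (auto simp: d_def)
      then show ?thesis using J by (simp add: d_def)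
    qed
    have "(\<Sum>j\<in>J. a m j * d j) = 0" if "m \<in> K" for m
    proof -
      have "(\<Sum>j\<in>J'. (a m j - a m l * a k j / a k l) * c j) =
          (\<Sum>j\<in>J'. a m j * c j) - a m l * (\<Sum>j\<in>J'. a k j * c j) / a k l"
        by (simp add: sum_subtractf sum_distrib_left sum_divide_distrib algebra_simps)
      with c(2) that d[of m] show ?thesis by simp
    qed
    moreover have "(\<Sum>j\<in>J. a k j * d j) = 0" using d[of k] l by simp
    moreover have "\<exists>j\<in>J. d j \<noteq> 0" using c(1) J by (auto simp: d_def)
    ultimately show ?thesis by (intro exI[of _ d]) auto
  qed
qed

text \<open>Moving the right-hand side to the left, multiplied by an additional unknown, gives a homogeneous
  system with one unknown more than equations. In a nontrivial solution the additional unknown cannot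
  vanish, by uniqueness, so the solution can be divided by it.\<close>

lemma square_system_solvable:
  fixes a :: "'k \<Rightarrow> 'j \<Rightarrow> real"
  assumes fin: "finite K" "finite J" and card: "card K = card J"
    and inj: "\<And>c. \<forall>k\<in>K. (\<Sum>j\<in>J. a k j * c j) = 0 \<Longrightarrow> \<forall>j\<in>J. c j = 0"
  shows "\<exists>c. \<forall>k\<in>K. (\<Sum>j\<in>J. a k j * c j) = z k"
proof -
  \<comment> \<open>The unknown indexed by \<open>None\<close> is the factor in front of the right-hand side.\<close>
  let ?J = "insert None (Some ` J)"
  let ?a = "\<lambda>k. case_option (- z k) (a k)"
  have "card K < card ?J" using fin card by (simp add: card_image)
  then obtain c where nontrivial: "\<exists>j\<in>?J. c j \<noteq> 0"
    and c: "\<forall>k\<in>K. (\<Sum>j\<in>?J. ?a k j * c j) = 0"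
    using homogeneous_system_nontrivial_solution[of K ?J ?a] fin by auto
  have c': "(\<Sum>j\<in>J. a k j * c (Some j)) = z k * c None" if "k \<in> K" for k
    using bspec[OF c that] fin by (simp add: sum.reindex)
  have "c None \<noteq> 0"
  proof
    assume 0: "c None = 0"
    then have "\<forall>j\<in>J. c (Some j) = 0" using inj[of "\<lambda>j. c (Some j)"] c' by simp
    with 0 nontrivial show False by auto
  qed
  then have "(\<Sum>j\<in>J. a k j * (c (Some j) / c None)) = z k" if "k \<in> K" for k
    using c'[OF that] by (simp add: sum_divide_distrib[symmetric])
  then show ?thesis by (intro exI[of _ "\<lambda>j. c (Some j) / c None"]) auto
qed

section \<open>Mesh and interfaces\<close>

lemma mesh_element:
  assumes "valid_fe_space V" "K \<in> mesh V"
  obtains a b where "a < b" "K = {a..b}" "{a..b} \<subseteq> {xL V..xR V}"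
proof -
  have d: "mesh V division_of {xL V..xR V}" and int: "interior K \<noteq> {}"
    using assms by (auto simp: valid_fe_space_def)
  obtain a b where K: "K = {a..b}" using division_ofD(4)[OF d assms(2)] by auto
  have "a < b" using int K by (auto simp: interior_atLeastAtMost_real)
  with K division_ofD(2)[OF d assms(2)] show thesis by (intro that) auto
qed

lemma mesh_covers:
  assumes "valid_fe_space V" "s \<in> {xL V..xR V}"
  obtains K where "K \<in> mesh V" "s \<in> K"
proof -
  have "\<Union>(mesh V) = {xL V..xR V}"
    using assms(1) by (auto simp: valid_fe_space_def dest: division_ofD(6))
  with assms(2) show thesis by (metis UnionE that)
qed

text \<open>Distinct elements have disjoint interiors, so a common point is the right end of one of
  them and the left end of the other.\<close>

lemma interface_elements:
  assumes "valid_fe_space V" "f \<in> interfaces V"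
  obtains a b where "a < f" "f < b" "{a..f} \<in> mesh V" "{f..b} \<in> mesh V"
proof -
  obtain K L where KL: "K \<in> mesh V" "L \<in> mesh V" "K \<noteq> L" "f \<in> K" "f \<in> L"
    using assms(2) by (auto simp: interfaces_def)
  obtain a b where K: "a < b" "K = {a..b}" by (rule mesh_element[OF assms(1) KL(1)])
  obtain c d where L: "c < d" "L = {c..d}" by (rule mesh_element[OF assms(1) KL(2)])
  have "interior K \<inter> interior L = {}"
    using assms(1) KL by (auto simp: valid_fe_space_def dest: division_ofD(5))
  then have "{a<..<b} \<inter> {c<..<d} = {}" using K L by simp
  then have "{max a c<..<min b d} = {}" by auto
  then have "b \<le> c \<or> d \<le> a" using K(1) L(1) by auto
  then show thesis
  proof
    assume "b \<le> c"
    then have "f = b" "f = c" using KL K L by auto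
    then show thesis using that K L KL by auto
  next
    assume "d \<le> a"
    then have "f = d" "f = a" using KL K L by auto
    then show thesis using that K L KL by auto
  qed
qed

lemma interface_in_interior:
  assumes "valid_fe_space V" "f \<in> interfaces V"
  shows "f \<in> {xL V<..<xR V}"
proof -
  obtain a b where ab: "a < f" "f < b" and K: "{a..f} \<in> mesh V" and L: "{f..b} \<in> mesh V"
    by (rule interface_elements[OF assms])
  have "\<And>K. K \<in> mesh V \<Longrightarrow> K \<subseteq> {xL V..xR V}" by (metis assms(1) mesh_element)
  from this[OF K] this[OF L] ab show ?thesis by auto
qed

section \<open>Piecewise polynomials\<close>

lemma W_derivative:
  assumes "w \<in> W V" "K \<in> mesh V"
  obtains p where "degree p \<le> deg V" "\<forall>s\<in>K. w s = poly p s"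
    "\<forall>s\<in>K. (w has_vector_derivative poly (pderiv p) s) (at s within K)"
proof -
  obtain p :: "real poly" where p: "degree p \<le> deg V" "\<forall>s\<in>K. w s = poly p s"
    using assms by (auto simp: W_def)
  have "(w has_vector_derivative poly (pderiv p) s) (at s within K)" if "s \<in> K" for s
  proof -
    have "(poly p has_vector_derivative poly (pderiv p) s) (at s within K)"
      using poly_DERIV[of p s]
      by (simp add: has_real_derivative_iff_has_vector_derivative has_vector_derivative_at_within)
    then show ?thesis
      by (rule has_vector_derivative_transform[rotated 2]) (use p that in auto)
  qed
  with p that show thesis by blast
qed

lemma W_lincomb:
  assumes "finite I" "\<And>i. i \<in> I \<Longrightarrow> \<phi> i \<in> W V"
  shows "(\<lambda>s. \<Sum>i\<in>I. c i * \<phi> i s) \<in> W V"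
proof -
  have "continuous_on {xL V..xR V} (\<lambda>s. \<Sum>i\<in>I. c i * \<phi> i s)"
    using assms by (intro continuous_intros) (auto simp: W_def)
  moreover have "\<exists>p. degree p \<le> deg V \<and> (\<forall>s\<in>K. (\<Sum>i\<in>I. c i * \<phi> i s) = poly p s)"
    if "K \<in> mesh V" for K
  proof -
    have "\<forall>i\<in>I. \<exists>p. degree p \<le> deg V \<and> (\<forall>s\<in>K. \<phi> i s = poly p s)"
      using assms(2) that by (auto simp: W_def)
    then obtain p where p: "\<forall>i\<in>I. degree (p i) \<le> deg V \<and> (\<forall>s\<in>K. \<phi> i s = poly (p i) s)"
      by metis
    have "degree (\<Sum>i\<in>I. smult (c i) (p i)) \<le> deg V"
      using p by (intro degree_sum_le assms(1)) (meson degree_smult_le order_trans)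
    moreover have "\<forall>s\<in>K. (\<Sum>i\<in>I. c i * \<phi> i s) = poly (\<Sum>i\<in>I. smult (c i) (p i)) s"
      using p by (auto simp: poly_sum intro!: sum.cong)
    ultimately show ?thesis by blast
  qed
  ultimately show ?thesis by (auto simp: W_def)
qed

lemma W_lincomb_shape:
  assumes "valid_fe_space V"
  shows "(\<lambda>s. \<Sum>i=1..num V. shape V i s * c i) \<in> W V"
  using W_lincomb[of "{1..num V}" "shape V" V c] assms
  by (simp add: valid_fe_space_def basis_of_W_def mult.commute)

lemma poly_zero_at_element_nodes:
  fixes p :: "real poly"
  assumes "valid_fe_space V" "K \<in> mesh V" "degree p \<le> deg V"
    and "\<forall>i\<in>{1..num V}. node V i \<in> K \<longrightarrow> poly p (node V i) = 0"
  shows "p = 0"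
proof (rule ccontr)
  assume "p \<noteq> 0"
  have "deg V + 1 = card (node V ` {1..num V} \<inter> K)"
    using assms(1,2) by (auto simp: valid_fe_space_def)
  also have "\<dots> \<le> card {x. poly p x = 0}"
    using assms(4) by (intro card_mono poly_roots_finite \<open>p \<noteq> 0\<close>) auto
  also have "\<dots> \<le> degree p" by (rule card_poly_roots_bound[OF \<open>p \<noteq> 0\<close>])
  finally show False using assms(3) by simp
qed

lemma W_zero_at_nodes:
  assumes "valid_fe_space V" "w \<in> W V" "\<forall>k\<in>{1..num V}. w (node V k) = 0"
    and "s \<in> {xL V..xR V}"
  shows "w s = 0"
proof -
  obtain K where K: "K \<in> mesh V" "s \<in> K" by (rule mesh_covers[OF assms(1,4)])
  obtain p :: "real poly" where p: "degree p \<le> deg V" "\<forall>s\<in>K. w s = poly p s"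
    using assms(2) K by (auto simp: W_def)
  have "p = 0" using p assms(3) by (intro poly_zero_at_element_nodes[OF assms(1) K(1)]) auto
  then show ?thesis using p K by simp
qed

section \<open>Interpolation\<close>

text \<open>The coefficients are the result of a choice, so their properties depend on the existence
  of some solution \<open>c\<close> of the interpolation conditions.\<close>

lemma interp_coeffs_at_nodes:
  fixes z :: "real \<Rightarrow> 'a::real_vector"
  assumes "\<forall>k\<in>{1..num V}. (\<Sum>j=1..num V. shape V j (node V k) *\<^sub>R c j) = z (node V k)"
    and "k \<in> {1..num V}"
  shows "interp V z (node V k) = z (node V k)"
  unfolding interp_def interp_coeffs_def using someI[where P = "\<lambda>c. \<forall>k\<in>{1..num V}.
      (\<Sum>j=1..num V. shape V j (node V k) *\<^sub>R c j) = z (node V k)", OF assms(1)] assms(2)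
  by blast

text \<open>Coefficients with vanishing nodal values give the zero function of \<open>W\<close> and hence vanish by
  linear independence; so the square system of interpolation conditions is solvable.\<close>

lemma interp_node:
  fixes z :: "real \<Rightarrow> real"
  assumes V: "valid_fe_space V" and "k \<in> {1..num V}"
  shows "interp V z (node V k) = z (node V k)"
proof -
  have "\<forall>j\<in>{1..num V}. c j = 0"
    if "\<forall>k\<in>{1..num V}. (\<Sum>j=1..num V. shape V j (node V k) * c j) = 0" for c
  proof -
    have "(\<Sum>j=1..num V. c j * shape V j s) = 0" if "s \<in> {xL V..xR V}" for s
      using W_zero_at_nodes[OF V W_lincomb_shape[OF V] _ that, of c]
        \<open>\<forall>k\<in>_. _\<close> by (simp add: mult.commute)
    then show ?thesis using V by (simp add: valid_fe_space_def basis_of_W_def)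
  qed
  then obtain c where
    "\<forall>k\<in>{1..num V}. (\<Sum>j=1..num V. shape V j (node V k) * c j) = z (node V k)"
    using square_system_solvable[of "{1..num V}" "{1..num V}" "\<lambda>k j. shape V j (node V k)"
        "\<lambda>k. z (node V k)"] by auto
  then show ?thesis using assms(2) by (intro interp_coeffs_at_nodes) auto
qed

lemma interp_in_W:
  fixes z :: "real \<Rightarrow> real"
  assumes "valid_fe_space V"
  shows "interp V z \<in> W V"
  using W_lincomb_shape[OF assms, of "interp_coeffs V z"] by (simp add: interp_def[abs_def])

text \<open>By the partition of unity, constant coefficients \<open>C\<close> also interpolate the values \<open>C\<close>. For
  vector-valued \<open>z\<close> uniqueness is reduced to the scalar space \<open>W\<close> by taking the inner product of the
  difference with a fixed vector \<open>x\<close>; finally \<open>x\<close> is the difference itself.\<close>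

lemma interp_const:
  fixes z :: "real \<Rightarrow> 'a::real_inner"
  assumes V: "valid_fe_space V" and z: "\<forall>k\<in>{1..num V}. z (node V k) = C"
    and s: "s \<in> {xL V..xR V}"
  shows "interp V z s = C"
proof -
  have unity: "(\<Sum>j=1..num V. shape V j t) = 1" if "t \<in> {xL V..xR V}" for t
    using V that by (auto simp: valid_fe_space_def)
  have nodes: "node V k \<in> {xL V..xR V}" if "k \<in> {1..num V}" for k
    using V that unfolding valid_fe_space_def by blast
  have dev: "(\<Sum>j=1..num V. shape V j t * (x \<bullet> (interp_coeffs V z j - C)))
      = x \<bullet> (interp V z t - C)" if "t \<in> {xL V..xR V}" for t x
  proof -
    have "(\<Sum>j=1..num V. shape V j t *\<^sub>R (interp_coeffs V z j - C)) = interp V z t - C"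
      using unity[OF that]
      by (simp add: interp_def scaleR_diff_right sum_subtractf scaleR_sum_left[symmetric])
    from this[symmetric] show ?thesis by (simp only: inner_sum_right inner_scaleR_right)
  qed
  \<comment> \<open>Constant coefficients show that the interpolation conditions are solvable.\<close>
  have "interp V z (node V k) = C" if "k \<in> {1..num V}" for k
    using interp_coeffs_at_nodes[of V "\<lambda>_. C" z k] z that nodes unity
    by (simp add: scaleR_sum_left[symmetric])
  then have "(\<Sum>j=1..num V. shape V j s * (x \<bullet> (interp_coeffs V z j - C))) = 0" for x
    using dev nodes
    by (intro W_zero_at_nodes[OF V W_lincomb_shape[OF V] _ s]) auto
  then have "(interp V z s - C) \<bullet> (interp V z s - C) = 0" using dev[OF s] by simp
  then show ?thesis by simp
qed

lemma elem_interp_poly: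
  assumes "valid_fe_space V" "K \<in> mesh V" "degree p \<le> deg V"
    and "\<forall>i\<in>{1..num V}. node V i \<in> K \<longrightarrow> z (node V i) = poly p (node V i)"
  shows "elem_interp V K z = poly p"
proof -
  have "(THE p. degree p \<le> deg V \<and>
     (\<forall>i\<in>{1..num V}. node V i \<in> K \<longrightarrow> poly p (node V i) = z (node V i))) = p"
  proof (rule the_equality)
    fix r assume r: "degree r \<le> deg V \<and>
     (\<forall>i\<in>{1..num V}. node V i \<in> K \<longrightarrow> poly r (node V i) = z (node V i))"
    have "r - p = 0"
      using r assms by (intro poly_zero_at_element_nodes[OF assms(1,2)] degree_diff_le) auto
    then show "r = p" by simp
  qed (use assms in auto)
  then show ?thesis by (simp add: elem_interp_def)
qed

section \<open>Jumps\<close>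

lemma jump_eq_0:
  assumes "(z \<longlongrightarrow> l) (at_left f)" "(z \<longlongrightarrow> l) (at_right f)"
  shows "jump z f = 0"
  using tendsto_Lim[OF _ assms(1)] tendsto_Lim[OF _ assms(2)] by (simp add: jump_def)

text \<open>Openness of \<open>S\<close> matters: \<open>ddx\<close> is a two-sided derivative.\<close>

lemma iterated_ddx_const:
  assumes "open S" "\<forall>s\<in>S. z s = C" "r \<ge> 1" "s \<in> S"
  shows "(ddx ^^ r) z s = 0"
  using assms(3,4)
proof (induction r arbitrary: s rule: dec_induct)
  case base
  have "(z has_vector_derivative 0) (at s)"
    using assms base
    by (intro has_vector_derivative_transform_within_open[of "\<lambda>_. C" 0 s S z]) auto
  then show ?case by (simp add: ddx_def vector_derivative_at)
next
  case (step r)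
  have "((ddx ^^ r) z has_vector_derivative 0) (at s)"
    by (rule has_vector_derivative_transform_within_open[of "\<lambda>_. 0" 0 s S])
      (use assms(1) step in auto)
  then show ?case by (simp add: ddx_def[of "(ddx ^^ r) z"] vector_derivative_at)
qed

lemma jump_iterated_ddx_const:
  assumes "valid_fe_space V" "f \<in> interfaces V" "\<forall>s\<in>{xL V..xR V}. z s = C" "r \<ge> 1"
  shows "jump ((ddx ^^ r) z) f = 0"
proof -
  have "(ddx ^^ r) z s = 0" if "s \<in> {xL V<..<xR V}" for s
    using assms that by (intro iterated_ddx_const[of "{xL V<..<xR V}"]) auto
  then have "\<forall>\<^sub>F s in nhds f. (ddx ^^ r) z s = 0"
    using interface_in_interior[OF assms(1,2)] by (auto simp: eventually_nhds)
  then have "((ddx ^^ r) z \<longlongrightarrow> 0) (at f)"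
    by (intro tendsto_eventually) (auto simp: eventually_at_filter elim: eventually_mono)
  then show ?thesis by (intro jump_eq_0[of _ 0]) (auto intro: filterlim_mono at_le)
qed

lemma jump_ddx_const:
  assumes "valid_fe_space V" "f \<in> interfaces V" "\<forall>s\<in>{xL V..xR V}. z s = C"
  shows "jump (ddx z) f = 0"
  using jump_iterated_ddx_const[OF assms, of 1] by simp

section \<open>Lake at rest\<close>

lemma lake_at_restD:
  assumes "lake_at_rest V B u etabar" "s \<in> {xL V..xR V}"
  shows "u s $ 1 = etabar - interp V B s" "u s $ 2 = 0"
  using assms unfolding lake_at_rest_def total_height_def by (simp_all add: eq_diff_eq)

lemma vector_0_eq_axis: "vector [0, x] = x *\<^sub>R (axis 2 1 :: real^2)"
  by (simp add: vec_eq_iff forall_2 axis_def)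

text \<open>At zero velocity the Jacobian at \<open>f\<close> sends \<open>(H', 0)\<close> to \<open>(0, g H(f) H')\<close>, while the source
  is \<open>(0, - g H(s) B\<^sub>h')\<close>; with \<open>H = \<eta> - B\<^sub>h\<close> the difference is proportional to
  \<open>H(s) - H(f)\<close>.\<close>

lemma residual_at_rest:
  assumes V: "valid_fe_space V" and lake: "lake_at_rest V B u etabar"
    and f: "f \<in> {xL V..xR V}" and ab: "{a..b} \<in> mesh V" and s: "s \<in> {a<..<b}"
  shows "jac g (u f) *v ddx u s - S_star V g B u s =
    (g * (interp V B f - interp V B s) * ddx (interp V B) s) *\<^sub>R axis 2 1"
proof -
  define b' where "b' = ddx (interp V B) s"
  obtain p where p:
    "\<forall>s\<in>{a..b}. (interp V B has_vector_derivative poly (pderiv p) s) (at s within {a..b})"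
    by (rule W_derivative[OF interp_in_W[OF V, of B] ab])
  have "(interp V B has_vector_derivative poly (pderiv p) s) (at s within {a..b})"
    using p s by auto
  then have "(interp V B has_vector_derivative poly (pderiv p) s) (at s)"
    using s at_within_Icc_at[of a s b] by simp
  then have B': "(interp V B has_vector_derivative b') (at s)"
    by (simp add: b'_def ddx_def vector_derivative_at)
  have sub: "{a..b} \<subseteq> {xL V..xR V}" by (metis V ab mesh_element)
  have u: "u t = (etabar - interp V B t) *\<^sub>R axis 1 1" if "t \<in> {a..b}" for t
    using lake_at_restD[OF lake, of t] sub that
    by (auto simp: vec_eq_iff forall_2 axis_def)
  have "((\<lambda>t. (etabar - interp V B t) *\<^sub>R (axis 1 1 :: real^2)) has_vector_derivative
      (0 - b') *\<^sub>R axis 1 1) (at s)"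
    by (intro bounded_linear.has_vector_derivative[OF bounded_linear_scaleR_left]
        has_vector_derivative_diff has_vector_derivative_const B')
  then have "(u has_vector_derivative (0 - b') *\<^sub>R axis 1 1) (at s)"
    by (rule has_vector_derivative_transform_within_open[of _ _ _ "{a<..<b}"]) (use s u in auto)
  then have "ddx u s = (- b') *\<^sub>R axis 1 1" by (simp add: ddx_def vector_derivative_at)
  moreover have "u s $ 1 = etabar - interp V B s" "u f $ 1 = etabar - interp V B f" "u f $ 2 = 0"
    using lake_at_restD[OF lake] f s sub by auto
  ultimately show ?thesis
    by (simp add: S_star_def b'_def[symmetric] jac_def vec_eq_iff forall_2 axis_def
        matrix_vector_mult_def sum_2) (simp add: algebra_simps)
qed

lemma residual_tendsto_0:
  assumes V: "valid_fe_space V" and lake: "lake_at_rest V B u etabar"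
    and ab: "{a..b} \<in> mesh V" and f: "f \<in> {a..b}"
  shows "((\<lambda>s. jac g (u f) *v ddx u s - S_star V g B u s) \<longlongrightarrow> 0) (at f within {a<..<b})"
proof -
  obtain p where p: "\<forall>s\<in>{a..b}. interp V B s = poly p s"
    "\<forall>s\<in>{a..b}. (interp V B has_vector_derivative poly (pderiv p) s) (at s within {a..b})"
    by (rule W_derivative[OF interp_in_W[OF V, of B] ab])
  have f': "f \<in> {xL V..xR V}" by (metis V ab f mesh_element subsetD)
  have ddx: "ddx (interp V B) s = poly (pderiv p) s" if "s \<in> {a<..<b}" for s
  proof -
    have "(interp V B has_vector_derivative poly (pderiv p) s) (at s within {a..b})"
      using p(2) that by simp
    then show ?thesis
      using that at_within_Icc_at[of a s b] by (simp add: ddx_def vector_derivative_at)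
  qed
  have eq: "jac g (u f) *v ddx u s - S_star V g B u s =
      (g * (poly p f - poly p s) * poly (pderiv p) s) *\<^sub>R axis 2 1" if "s \<in> {a<..<b}" for s
    using residual_at_rest[OF V lake f' ab that, of g] ddx[OF that] p(1) f that by simp
  have "((\<lambda>s. (g * (poly p f - poly p s) * poly (pderiv p) s) *\<^sub>R (axis 2 1 :: real^2))
      \<longlongrightarrow> (g * (poly p f - poly p f) * poly (pderiv p) f) *\<^sub>R axis 2 1) (at f within {a<..<b})"
    by (intro tendsto_intros)
  then have "((\<lambda>s. (g * (poly p f - poly p s) * poly (pderiv p) s) *\<^sub>R (axis 2 1 :: real^2))
      \<longlongrightarrow> 0) (at f within {a<..<b})" by simp
  then show ?thesis
    by (rule Lim_transform_eventually) (simp add: eventually_at_filter eq)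
qed

lemma jump_residual_eq_0:
  assumes V: "valid_fe_space V" and lake: "lake_at_rest V B u etabar" and f: "f \<in> interfaces V"
  shows "jump (\<lambda>s. jac g (u f) *v ddx u s - S_star V g B u s) f = 0"
proof -
  obtain a b where ab: "a < f" "f < b" and K: "{a..f} \<in> mesh V" and L: "{f..b} \<in> mesh V"
    by (rule interface_elements[OF V f])
  have "at f within {a<..<f} = at_left f"
    by (rule at_within_nhd[of f "{a<..}"]) (use ab in auto)
  moreover have "at f within {f<..<b} = at_right f"
    by (rule at_within_nhd[of f "{..<b}"]) (use ab in auto)
  ultimately show ?thesis
    using residual_tendsto_0[OF V lake K, of f g] residual_tendsto_0[OF V lake L, of f g] ab
    by (intro jump_eq_0[of _ 0]) auto
qed

lemma entropy_var_at_node: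
  assumes V: "valid_fe_space V" and lake: "lake_at_rest V B u etabar" and k: "k \<in> {1..num V}"
  shows "entropy_var g B u (node V k) = vector [g * etabar, 0]"
proof -
  have "node V k \<in> {xL V..xR V}" using V k unfolding valid_fe_space_def by blast
  from lake_at_restD[OF lake this] interp_node[OF V k, of B] show ?thesis
    by (simp add: entropy_var_def velocity_def)
qed

section \<open>The global flux\<close>

lemma friction_interp_at_rest:
  assumes V: "valid_fe_space V" and lake: "lake_at_rest V B u etabar" and s: "s \<in> {xL V..xR V}"
  shows "(\<Sum>j=1..num V. shape V j s *\<^sub>R interp_coeffs V (\<lambda>t. friction g nM (u t)) j) = 0"
proof -
  have "friction g nM (u (node V k)) = 0" if "k \<in> {1..num V}" for k
  proof -
    have "node V k \<in> {xL V..xR V}" using V that unfolding valid_fe_space_def by blast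
    from lake_at_restD(2)[OF lake this] show ?thesis
      by (simp add: friction_def vector_0_eq_axis)
  qed
  then have "interp V (\<lambda>t. friction g nM (u t)) s = 0"
    by (intro interp_const[OF V _ s]) auto
  then show ?thesis by (simp add: interp_def)
qed

text \<open>At rest this is an antiderivative of the discrete bathymetry source: the first summand
  comes from \<open>[g (H + B) B']\<close> with \<open>H + B = \<eta>\<close>.\<close>

definition hydrostatic_primitive ::
  "fe_space \<Rightarrow> real \<Rightarrow> real \<Rightarrow> (real \<Rightarrow> real) \<Rightarrow> real \<Rightarrow> real" where
  "hydrostatic_primitive V g etabar B s =
     g * etabar * interp V B s - interp V (\<lambda>y. g * (B y)\<^sup>2 / 2) s"

text \<open>Removing the boundary points of all elements makes any element that contains \<open>s\<close> a
  neighbourhood of \<open>s\<close>, so the choice of the element in \<open>gHBx\<close> is harmless and derivatives within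
  the element are derivatives.\<close>

lemma hydrostatic_primitive_derivative:
  assumes V: "valid_fe_space V" and lake: "lake_at_rest V B u etabar"
    and s: "s \<in> {xL V..xR V} - (\<Union>K\<in>mesh V. K - interior K)"
  shows "(hydrostatic_primitive V g etabar B has_vector_derivative gHBx V g B u s) (at s)"
proof -
  let ?Q = "interp V (\<lambda>y. g * (B y)\<^sup>2 / 2)"
  define K where "K = (SOME K. K \<in> mesh V \<and> s \<in> K)"
  have K: "K \<in> mesh V" "s \<in> K"
    using someI_ex[of "\<lambda>K. K \<in> mesh V \<and> s \<in> K"] mesh_covers[OF V, of s] s
    unfolding K_def by blast+
  obtain a b where ab: "a < b" "K = {a..b}" "{a..b} \<subseteq> {xL V..xR V}"
    by (rule mesh_element[OF V K(1)])
  have s': "s \<in> {a<..<b}" using s K ab by auto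
  obtain p where p: "degree p \<le> deg V" "\<forall>s\<in>K. interp V B s = poly p s"
    "\<forall>s\<in>K. (interp V B has_vector_derivative poly (pderiv p) s) (at s within K)"
    by (rule W_derivative[OF interp_in_W[OF V, of B] K(1)])
  obtain r where
    "\<forall>s\<in>K. (?Q has_vector_derivative poly (pderiv r) s) (at s within K)"
    by (rule W_derivative[OF interp_in_W[OF V] K(1)])
  then have Q: "(?Q has_vector_derivative poly (pderiv r) s) (at s within K)" using K(2) by blast
  have slope: "vector_derivative w (at t within K) = d"
    if "(w has_vector_derivative d) (at t within K)" "t \<in> K" for w :: "real \<Rightarrow> real" and d t
    using that vector_derivative_within_closed_interval[OF ab(1)] unfolding ab(2) by blast
  \<comment> \<open>The interpolated function is a polynomial of degree below \<open>deg V\<close>, hence reproduced.\<close>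
  have "elem_interp V K (\<lambda>y. g * (u y $ 1 + interp V B y) *
      vector_derivative (interp V B) (at y within K)) = poly (smult (g * etabar) (pderiv p))"
  proof (rule elem_interp_poly[OF V K(1)])
    show "degree (smult (g * etabar) (pderiv p)) \<le> deg V"
      using p(1) degree_smult_le[of "g * etabar" "pderiv p"] by (simp add: degree_pderiv)
    show "\<forall>i\<in>{1..num V}. node V i \<in> K \<longrightarrow>
      g * (u (node V i) $ 1 + interp V B (node V i)) *
        vector_derivative (interp V B) (at (node V i) within K) =
      poly (smult (g * etabar) (pderiv p)) (node V i)"
    proof (intro ballI impI)
      fix i assume i: "i \<in> {1..num V}" "node V i \<in> K"
      have "u (node V i) $ 1 + interp V B (node V i) = etabar"
        using lake_at_restD(1)[OF lake, of "node V i"] i ab by auto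
      moreover have "vector_derivative (interp V B) (at (node V i) within K) =
          poly (pderiv p) (node V i)" using slope p(3) i(2) by blast
      ultimately show "g * (u (node V i) $ 1 + interp V B (node V i)) *
        vector_derivative (interp V B) (at (node V i) within K) =
        poly (smult (g * etabar) (pderiv p)) (node V i)" by simp
    qed
  qed
  then have "gHBx V g B u s = g * etabar * poly (pderiv p) s - poly (pderiv r) s"
    using slope[OF Q K(2)] by (simp add: gHBx_def gHBx_elem_def K_def[symmetric])
  moreover have "(interp V B has_vector_derivative poly (pderiv p) s) (at s within K)"
    using p(3) K(2) by blast
  ultimately have "(hydrostatic_primitive V g etabar B has_vector_derivative gHBx V g B u s)
      (at s within K)"
    unfolding hydrostatic_primitive_def[abs_def]
    using Q by (auto intro!: has_vector_derivative_diff has_vector_derivative_mult_right)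
  then show ?thesis using at_within_Icc_at[of a s b] s' ab(2) by simp
qed

text \<open>The primitive is continuous across interfaces and fails to be differentiable at finitely
  many points only, so the fundamental theorem of calculus applies on all of \<open>[xL, y]\<close>. The friction
  has zero nodal values and does not contribute.\<close>

lemma R_h_at_rest:
  assumes V: "valid_fe_space V" and lake: "lake_at_rest V B u etabar" and y: "y \<in> {xL V..xR V}"
  shows "R_h V g nM B u y =
    (hydrostatic_primitive V g etabar B y - hydrostatic_primitive V g etabar B (xL V)) *\<^sub>R axis 2 1"
proof -
  let ?\<Phi> = "hydrostatic_primitive V g etabar B"
  define E where "E = (\<Union>K\<in>mesh V. K - interior K)"
  have "finite (K - interior K)" if K: "K \<in> mesh V" for K
  proof -
    obtain a b where "a < b" "K = {a..b}" by (rule mesh_element[OF V K])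
    then have "K - interior K \<subseteq> {a, b}" by auto
    then show ?thesis by (rule finite_subset) simp
  qed
  then have "finite E" using V by (auto simp: E_def valid_fe_space_def division_of_finite)
  have "continuous_on {xL V..xR V} (interp V z)"
    for z :: "real \<Rightarrow> real"
    using interp_in_W[OF V, of z] by (simp add: W_def)
  then have "continuous_on {xL V..xR V} ?\<Phi>"
    unfolding hydrostatic_primitive_def[abs_def] by (intro continuous_intros)
  then have "continuous_on {xL V..y} ?\<Phi>" by (rule continuous_on_subset) (use y in auto)
  then have "(gHBx V g B u has_integral ?\<Phi> y - ?\<Phi> (xL V)) {xL V..y}"
    using y by (intro fundamental_theorem_of_calculus_interior_strong[OF \<open>finite E\<close>]
        hydrostatic_primitive_derivative[OF V lake]) (auto simp: E_def)
  then have "((\<lambda>s. - (gHBx V g B u s *\<^sub>R axis 2 1 :: real^2)) has_integral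
      - ((?\<Phi> y - ?\<Phi> (xL V)) *\<^sub>R axis 2 1)) {xL V..y}"
    by (intro has_integral_neg has_integral_scaleR_left)
  then have "integral {xL V..y} (\<lambda>s. - (gHBx V g B u s *\<^sub>R axis 2 1 :: real^2)) =
      - ((?\<Phi> y - ?\<Phi> (xL V)) *\<^sub>R axis 2 1)"
    by (rule integral_unique)
  moreover have "integral {xL V..y} (\<lambda>s. - vector [0, gHBx V g B u s] +
      (\<Sum>j=1..num V. shape V j s *\<^sub>R interp_coeffs V (\<lambda>t. friction g nM (u t)) j)) =
      integral {xL V..y} (\<lambda>s. - (gHBx V g B u s *\<^sub>R axis 2 1 :: real^2))"
    using friction_interp_at_rest[OF V lake] y
    by (intro Henstock_Kurzweil_Integration.integral_cong) (simp add: vector_0_eq_axis)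
  ultimately show ?thesis unfolding R_h_def by (simp only: minus_minus)
qed

text \<open>At the nodes pressure and primitive cancel up to a constant:
  \<open>(\<eta> - b)\<^sup>2 / 2 + \<eta> b - b\<^sup>2 / 2 = \<eta>\<^sup>2 / 2\<close>.\<close>

lemma global_flux_at_rest:
  assumes V: "valid_fe_space V" and lake: "lake_at_rest V B u etabar" and s: "s \<in> {xL V..xR V}"
  shows "global_flux V g nM B u s =
    (g * etabar\<^sup>2 / 2 - hydrostatic_primitive V g etabar B (xL V)) *\<^sub>R axis 2 1"
  unfolding global_flux_def
proof (rule interp_const[OF V _ s], intro ballI)
  fix k assume k: "k \<in> {1..num V}"
  let ?y = "node V k"
  have y: "?y \<in> {xL V..xR V}" using V k unfolding valid_fe_space_def by blast
  have "flux g (u ?y) = (g * (etabar - B ?y)\<^sup>2 / 2) *\<^sub>R axis 2 1"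
    using lake_at_restD[OF lake y] interp_node[OF V k, of B]
    by (simp add: flux_def vector_0_eq_axis)
  moreover have "hydrostatic_primitive V g etabar B ?y = g * etabar * B ?y - g * (B ?y)\<^sup>2 / 2"
    using interp_node[OF V k] by (simp add: hydrostatic_primitive_def)
  moreover have "g * (etabar - b)\<^sup>2 / 2 + (g * etabar * b - g * b\<^sup>2 / 2 - C) = g * etabar\<^sup>2 / 2 - C"
    for b C by (simp add: power2_eq_square field_simps)
  ultimately show "flux g (u ?y) + R_h V g nM B u ?y =
      (g * etabar\<^sup>2 / 2 - hydrostatic_primitive V g etabar B (xL V)) *\<^sub>R axis 2 1"
    using R_h_at_rest[OF V lake y] by (simp add: scaleR_add_left[symmetric])
qed

section \<open>Vanishing of the stabilization terms\<close>

theorem proposition4p3: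
  fixes V :: fe_space
    and g nM etabar :: real
    and R :: nat
    and B :: "real \<Rightarrow> real"
    and u :: "real \<Rightarrow> real^2"
    and \<alpha>t :: "real \<Rightarrow> nat \<Rightarrow> real"
    and \<alpha>e \<alpha>r \<alpha>g :: "real \<Rightarrow> real"
  assumes "valid_fe_space V"
    and "g > 0" and "nM \<ge> 0" and "R \<ge> 1"
    and "numerical_solution V u"
    and "lake_at_rest V B u etabar"
  shows "\<forall>i\<in>{1..num V}.
      ST_jt V \<alpha>t R B u i = 0 \<and>
      ST_je V \<alpha>e g B u i = 0 \<and>
      ST_jr V \<alpha>r g B u i = 0 \<and>
      ST_jg V \<alpha>g g nM B u i = 0"
proof (intro ballI conjI)
  note V = assms(1) and lake = assms(6)
  fix i
  have "jump ((ddx ^^ r) (\<lambda>s. vector [total_height V B u s, u s $ 2] :: real^2)) f = 0"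
    if "f \<in> interfaces V" "r \<in> {1..R}" for f r
    using lake that
    by (intro jump_iterated_ddx_const[OF V, where C = "vector [etabar, 0]"])
      (auto simp: lake_at_rest_def)
  then show "ST_jt V \<alpha>t R B u i = 0" by (simp add: ST_jt_def)
  have "interp V (entropy_var g B u) s = vector [g * etabar, 0]" if "s \<in> {xL V..xR V}" for s
    using entropy_var_at_node[OF V lake] that by (intro interp_const[OF V]) auto
  then have "jump (ddx (interp V (entropy_var g B u))) f = 0" if "f \<in> interfaces V" for f
    using that by (intro jump_ddx_const[OF V]) auto
  then show "ST_je V \<alpha>e g B u i = 0" by (simp add: ST_je_def)
  show "ST_jr V \<alpha>r g B u i = 0"
    using jump_residual_eq_0[OF V lake] by (simp add: ST_jr_def)
  have "jump (ddx (global_flux V g nM B u)) f = 0" if "f \<in> interfaces V" for f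
    using that global_flux_at_rest[OF V lake] by (intro jump_ddx_const[OF V]) auto
  then show "ST_jg V \<alpha>g g nM B u i = 0" by (simp add: ST_jg_def)
qed

end
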